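(* Let $A$, $B$ be nonsingular square integer matrices of sizes $N$ and $N'$, with dimension groups $G(A)=\bigcup_{n\ge0}A^{-n}\mathbb{Z}^N$ and $G(B)=\bigcup_{n\ge0}B^{-n}\mathbb{Z}^{N'}$. Let $L\subset G(A)$ be a rank-$N$ lattice with $AL\subset L$ and $\bigcup_{n\ge0}A^{-n}L=G(A)$, and let $L'\subset G(B)$ be a rank-$N'$ lattice with $BL'\subset L'$ and $\bigcup_{n\ge0}B^{-n}L'=G(B)$. If $G(A)\cong G(B)$ as groups, then $G(A)/L\cong G(B)/L'$ as groups.
   Context: A rank-$N$ lattice in $G(A)\subset\mathbb{Q}^N$ is a free abelian subgroup of rank $N$. Matrices act on column vectors. *)

theory Defs
  imports "HOL-Analysis.Analysis" "HOL-Algebra.Free_Abelian_Groups"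
begin

text \<open>Subgroups of \<open>\<rat>\<^sup>N\<close> are sets of vectors in \<open>rat ^ 'n\<close> with \<open>N = CARD('n)\<close>. This turns such a
  set into an additive group in the record format of HOL-Algebra.\<close>

definition vgroup :: "(rat ^ 'n) set \<Rightarrow> (rat ^ 'n) monoid"
  where "vgroup S = \<lparr>carrier = S, monoid.mult = (+), one = 0\<rparr>"

definition rat_matrix :: "int ^ 'n ^ 'm \<Rightarrow> rat ^ 'n ^ 'm"
  where "rat_matrix A = map_matrix rat_of_int A"

definition int_vectors :: "(rat ^ 'n) set"
  where "int_vectors = {x. \<forall>i. x $ i \<in> \<int>}"

text \<open>\<open>\<Union>\<^sub>n A\<^sup>-\<^sup>n S\<close>. The power \<open>A\<^sup>-\<^sup>n\<close> is an iterate of the map \<open>x \<mapsto> A\<^sup>-\<^sup>1 x\<close>, since \<open>^\<close> on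
  vectors of vectors would be a componentwise operation and not a matrix power.\<close>

definition inverse_images :: "int ^ 'n ^ 'n \<Rightarrow> (rat ^ 'n) set \<Rightarrow> (rat ^ 'n) set"
  where "inverse_images A S = (\<Union>n. (((*v) (matrix_inv (rat_matrix A))) ^^ n) ` S)"

definition dimension_group :: "int ^ 'n ^ 'n \<Rightarrow> (rat ^ 'n) set"
  where "dimension_group A = inverse_images A int_vectors"

definition lattice_of_rank :: "nat \<Rightarrow> (rat ^ 'n) set \<Rightarrow> (rat ^ 'n) set \<Rightarrow> bool"
  where "lattice_of_rank r G L \<longleftrightarrow>
    subgroup L (vgroup G) \<and> vgroup L \<cong> free_Abelian_group {..<r}"

lemma det_rat_matrix: "det (rat_matrix A) = rat_of_int (det A)"
  by (simp add: det_def rat_matrix_def)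

lemma rat_matrix_inverse:
  assumes "det A \<noteq> 0"
  shows "rat_matrix A ** matrix_inv (rat_matrix A) = mat 1"
    and "matrix_inv (rat_matrix A) ** rat_matrix A = mat 1"
proof -
  have "invertible (rat_matrix A)"
    using assms by (simp add: invertible_det_nz det_rat_matrix)
  then have "\<exists>A'. rat_matrix A ** A' = mat 1 \<and> A' ** rat_matrix A = mat 1"
    by (simp add: invertible_def)
  then have "rat_matrix A ** matrix_inv (rat_matrix A) = mat 1 \<and>
      matrix_inv (rat_matrix A) ** rat_matrix A = mat 1"
    unfolding matrix_inv_def by (rule someI_ex)
  then show "rat_matrix A ** matrix_inv (rat_matrix A) = mat 1"
    and "matrix_inv (rat_matrix A) ** rat_matrix A = mat 1" by auto
qed

lemma mem_inverse_images_iff: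
  assumes "det A \<noteq> 0"
  shows "x \<in> inverse_images A S \<longleftrightarrow> (\<exists>n. (((*v) (rat_matrix A)) ^^ n) x \<in> S)"
proof -
  let ?f = "(*v) (rat_matrix A)" and ?g = "(*v) (matrix_inv (rat_matrix A))"
  have "?f \<circ> ?g = id" "?g \<circ> ?f = id"
    using rat_matrix_inverse[OF assms] by (auto simp: fun_eq_iff matrix_vector_mul_assoc)
  then have fg: "?f (?g y) = y" and gf: "?g (?f y) = y" for y
    by (metis comp_apply id_apply)+
  have fgn: "(?f ^^ n) ((?g ^^ n) y) = y" for n y
  proof (induction n)
    case (Suc n)
    have "(?f ^^ Suc n) ((?g ^^ Suc n) y) = (?f ^^ n) (?f (?g ((?g ^^ n) y)))"
      by (simp add: funpow_swap1)
    then show ?case by (simp only: fg Suc)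
  qed simp
  have gfn: "(?g ^^ n) ((?f ^^ n) y) = y" for n y
  proof (induction n)
    case (Suc n)
    have "(?g ^^ Suc n) ((?f ^^ Suc n) y) = (?g ^^ n) (?g (?f ((?f ^^ n) y)))"
      by (simp add: funpow_swap1)
    then show ?case by (simp only: gf Suc)
  qed simp
  show ?thesis
    unfolding inverse_images_def
    by (auto simp: fgn) (metis fgn gfn image_eqI)+
qed

lemma vgroup_simps [simp]:
  "carrier (vgroup S) = S" "x \<otimes>\<^bsub>vgroup S\<^esub> y = x + y" "\<one>\<^bsub>vgroup S\<^esub> = 0"
  by (simp_all add: vgroup_def)

lemma comm_group_dimension_group:
  assumes "det A \<noteq> 0"
  shows "comm_group (vgroup (dimension_group A))"
proof -
  let ?f = "(*v) (rat_matrix A)"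
  have f_int: "?f x \<in> int_vectors" if "x \<in> int_vectors" for x
    using that by (auto simp: int_vectors_def rat_matrix_def matrix_vector_mult_def intro!: Ints_sum)
  have fn_int: "(?f ^^ k) x \<in> int_vectors" if "x \<in> int_vectors" for x k
    by (induction k) (auto simp: that f_int)
  have fn_add: "(?f ^^ k) (x + y) = (?f ^^ k) x + (?f ^^ k) y" for k x y
    by (induction k) (simp_all add: matrix_vector_right_distrib)
  have fn_0: "(?f ^^ k) 0 = 0" for k
    by (induction k) simp_all
  have fn_minus: "(?f ^^ k) (- x) = - (?f ^^ k) x" for k x
    using fn_add[of k x "- x"] by (simp add: fn_0 eq_neg_iff_add_eq_0 add.commute)
  have mem: "x \<in> dimension_group A \<longleftrightarrow> (\<exists>n. (?f ^^ n) x \<in> int_vectors)" for x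
    by (simp add: dimension_group_def mem_inverse_images_iff[OF assms])
  have int_add: "x + y \<in> int_vectors" if "x \<in> int_vectors" "y \<in> int_vectors" for x y :: "rat ^ 'a"
    using that by (simp add: int_vectors_def)
  have add: "x + y \<in> dimension_group A" if xy: "x \<in> dimension_group A" "y \<in> dimension_group A" for x y
  proof -
    obtain m n where "(?f ^^ m) x \<in> int_vectors" "(?f ^^ n) y \<in> int_vectors"
      using xy mem by blast
    then have "(?f ^^ (n + m)) x \<in> int_vectors" "(?f ^^ (m + n)) y \<in> int_vectors"
      by (simp_all add: funpow_add fn_int)
    then have "(?f ^^ (m + n)) (x + y) \<in> int_vectors"
      by (simp add: fn_add int_add add.commute)
    then show ?thesis using mem by blast
  qed
  have zero: "0 \<in> dimension_group A"
    unfolding mem by (rule exI[of _ 0]) (simp add: int_vectors_def)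
  have minus: "- x \<in> dimension_group A" if "x \<in> dimension_group A" for x
    using that unfolding mem by (auto simp: fn_minus int_vectors_def)
  show ?thesis
  proof (rule comm_groupI)
    fix x assume "x \<in> carrier (vgroup (dimension_group A))"
    then show "\<exists>y\<in>carrier (vgroup (dimension_group A)).
        y \<otimes>\<^bsub>vgroup (dimension_group A)\<^esub> x = \<one>\<^bsub>vgroup (dimension_group A)\<^esub>"
      by (intro bexI[of _ "- x"]) (simp_all add: minus)
  qed (simp_all add: add zero add.assoc add.commute)
qed

end

theory Submission
  imports Defs
begin

text \<open>For a prime \<open>p\<close>, finitely many elements of \<open>G = G(A)\<close> are carried into \<open>L\<close> by a single power of
  the automorphism \<open>A\<close>. Hence \<open>G/pG\<close> is finite and \<open>G = L + pG\<close>, so that \<open>G/L\<close> is a divisible torsion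
  group and \<open>0 \<rightarrow> (G/L)[p] \<rightarrow> L/pL \<rightarrow> G/pG \<rightarrow> 0\<close> is exact. Therefore \<open>(G/L)[p]\<close> has
  \<open>p\<^sup>N / card (G/pG)\<close> elements, a number that depends only on the group \<open>G\<close>, since \<open>N\<close> is its rank.
  Two divisible torsion groups whose \<open>p\<close>-torsion subgroups are finite of equal order for every \<open>p\<close>
  are isomorphic: a maximal isomorphism between subgroups is total on both sides.\<close>

subsection \<open>Divisible torsion groups\<close>

text \<open>Partial isomorphisms are kept as relations so that swapping the two groups is just taking
  the converse.\<close>

locale partial_iso = G: comm_group G + H: comm_group H
  for G :: "('a, 'c) monoid_scheme" and H :: "('b, 'd) monoid_scheme" +
  fixes R :: "('a \<times> 'b) set"
  assumes subgroup_R: "subgroup R (G \<times>\<times> H)"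
    and one_iff: "(x, y) \<in> R \<Longrightarrow> x = \<one>\<^bsub>G\<^esub> \<longleftrightarrow> y = \<one>\<^bsub>H\<^esub>"
begin

lemma one_mem: "(\<one>\<^bsub>G\<^esub>, \<one>\<^bsub>H\<^esub>) \<in> R"
  using subgroup.one_closed[OF subgroup_R] by simp

lemma mem_carrier: "(x, y) \<in> R \<Longrightarrow> x \<in> carrier G \<and> y \<in> carrier H"
  using subgroup.subset[OF subgroup_R] by auto

lemma mult_mem: "(x, y) \<in> R \<Longrightarrow> (x', y') \<in> R \<Longrightarrow> (x \<otimes>\<^bsub>G\<^esub> x', y \<otimes>\<^bsub>H\<^esub> y') \<in> R"
  using subgroup.m_closed[OF subgroup_R] by fastforce

lemma inv_mem: "(x, y) \<in> R \<Longrightarrow> (inv\<^bsub>G\<^esub> x, inv\<^bsub>H\<^esub> y) \<in> R"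
  using subgroup.m_inv_closed[OF subgroup_R] mem_carrier
  by (metis G.is_group H.is_group inv_DirProd)

lemma nat_pow_mem: "(x, y) \<in> R \<Longrightarrow> (x [^]\<^bsub>G\<^esub> (n::nat), y [^]\<^bsub>H\<^esub> n) \<in> R"
  by (induction n) (auto simp: one_mem mult_mem)

lemma int_pow_mem: "(x, y) \<in> R \<Longrightarrow> (x [^]\<^bsub>G\<^esub> (i::int), y [^]\<^bsub>H\<^esub> i) \<in> R"
  using nat_pow_mem inv_mem unfolding int_pow_def2[of _ x i] int_pow_def2[of _ y i] by presburger

text \<open>Quotients of pairs stay in \<open>R\<close>, so \<open>one_iff\<close> extends from
  neutral elements to arbitrary ones: \<open>R\<close> is the graph of a bijection between its
  domain and its range.\<close>

lemma eq_iff: assumes "(x, y) \<in> R" "(x', y') \<in> R" shows "x = x' \<longleftrightarrow> y = y'"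
proof -
  have "(x \<otimes>\<^bsub>G\<^esub> inv\<^bsub>G\<^esub> x', y \<otimes>\<^bsub>H\<^esub> inv\<^bsub>H\<^esub> y') \<in> R"
    using assms by (intro mult_mem inv_mem)
  moreover have "x = x' \<longleftrightarrow> x \<otimes>\<^bsub>G\<^esub> inv\<^bsub>G\<^esub> x' = \<one>\<^bsub>G\<^esub>"
    using mem_carrier[OF assms(1)] mem_carrier[OF assms(2)] G.right_cancel[of "inv\<^bsub>G\<^esub> x'" x x']
    by simp
  moreover have "y = y' \<longleftrightarrow> y \<otimes>\<^bsub>H\<^esub> inv\<^bsub>H\<^esub> y' = \<one>\<^bsub>H\<^esub>"
    using mem_carrier[OF assms(1)] mem_carrier[OF assms(2)] H.right_cancel[of "inv\<^bsub>H\<^esub> y'" y y']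
    by simp
  ultimately show ?thesis using one_iff by blast
qed

lemma converse: "partial_iso H G (R\<inverse>)"
proof (intro partial_iso.intro partial_iso_axioms.intro)
  show "subgroup (R\<inverse>) (H \<times>\<times> G)"
  proof (rule subgroup.intro)
    fix z assume z: "z \<in> R\<inverse>"
    then obtain x y where "z = (y, x)" "(x, y) \<in> R" by auto
    then show "inv\<^bsub>H \<times>\<times> G\<^esub> z \<in> R\<inverse>"
      using mem_carrier inv_mem by (auto simp: inv_DirProd[OF H.is_group G.is_group])
  qed (use one_mem mem_carrier mult_mem in auto)
qed (use one_iff in \<open>auto intro: G.comm_group_axioms H.comm_group_axioms\<close>)

end

section \<open>Starting point and unions of chains for Zorn's lemma\<close>

lemma partial_iso_singleton:
  assumes "comm_group G" "comm_group H"
  shows "partial_iso G H {(\<one>\<^bsub>G\<^esub>, \<one>\<^bsub>H\<^esub>)}"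
proof -
  interpret G: comm_group G by fact
  interpret H: comm_group H by fact
  show ?thesis
  proof (intro partial_iso.intro partial_iso_axioms.intro)
    show "subgroup {(\<one>\<^bsub>G\<^esub>, \<one>\<^bsub>H\<^esub>)} (G \<times>\<times> H)"
      using group.triv_subgroup[OF DirProd_group[OF G.is_group H.is_group]] by simp
  qed (use assms in auto)
qed

text \<open>Any two pairs in the union already lie in one member of the chain, where closure can be
  checked. Nonemptiness of \<open>C\<close> supplies the neutral pair.\<close>

lemma partial_iso_Union_chain:
  assumes "C \<noteq> {}" and chain: "subset.chain {R. partial_iso G H R} C"
  shows "partial_iso G H (\<Union>C)"
proof -
  have pi: "partial_iso G H R" if "R \<in> C" for R
    using chain that by (auto simp: subset.chain_def)
  obtain R0 where R0: "R0 \<in> C" using assms(1) by auto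
  interpret R0: partial_iso G H R0 by (rule pi[OF R0])
  show ?thesis
  proof (intro partial_iso.intro partial_iso_axioms.intro)
    show "subgroup (\<Union>C) (G \<times>\<times> H)"
    proof (rule subgroup.intro)
      show "\<Union>C \<subseteq> carrier (G \<times>\<times> H)"
        using subgroup.subset[OF partial_iso.subgroup_R[OF pi]] by blast
      show "\<one>\<^bsub>G \<times>\<times> H\<^esub> \<in> \<Union>C" using R0 R0.one_mem by auto
    next
      fix z w assume "z \<in> \<Union>C" "w \<in> \<Union>C"
      then obtain S T where ST: "S \<in> C" "z \<in> S" "T \<in> C" "w \<in> T" by auto
      then have "S \<subseteq> T \<or> T \<subseteq> S"
        using chain by (auto simp: subset.chain_def)
      then obtain U where "U \<in> C" "z \<in> U" "w \<in> U" using ST by blast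
      then show "z \<otimes>\<^bsub>G \<times>\<times> H\<^esub> w \<in> \<Union>C"
        using subgroup.m_closed[OF partial_iso.subgroup_R[OF pi]] by blast
    next
      fix z assume "z \<in> \<Union>C"
      then show "inv\<^bsub>G \<times>\<times> H\<^esub> z \<in> \<Union>C"
        using subgroup.m_inv_closed[OF partial_iso.subgroup_R[OF pi]] by blast
    qed
  next
    show "comm_group G" "comm_group H" by (fact R0.G.comm_group_axioms R0.H.comm_group_axioms)+
  next
    fix x y assume "(x, y) \<in> \<Union>C"
    then show "x = \<one>\<^bsub>G\<^esub> \<longleftrightarrow> y = \<one>\<^bsub>H\<^esub>" using partial_iso.one_iff[OF pi] by blast
  qed
qed

section \<open>Adjoining one pair to a partial isomorphism\<close>

text \<open>For a partial isomorphism \<open>R\<close> and \<open>x\<close>, \<open>y\<close> in the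
  carriers, this is the subgroup of \<open>G \<times>\<times> H\<close> generated by
  \<open>R\<close> and \<open>(x, y)\<close>; commutativity makes products of this shape
  suffice.\<close>

definition adjoin ::
    "('a, 'c) monoid_scheme \<Rightarrow> ('b, 'd) monoid_scheme \<Rightarrow> ('a \<times> 'b) set \<Rightarrow> 'a \<Rightarrow> 'b \<Rightarrow> ('a \<times> 'b) set"
  where "adjoin G H R x y =
    {(a \<otimes>\<^bsub>G\<^esub> x [^]\<^bsub>G\<^esub> i, b \<otimes>\<^bsub>H\<^esub> y [^]\<^bsub>H\<^esub> i) | a b (i::int). (a, b) \<in> R}"

lemma converse_adjoin: "(adjoin G H R x y)\<inverse> = adjoin H G (R\<inverse>) y x"
  unfolding adjoin_def by (simp add: set_eq_iff) blast

context partial_iso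
begin

text \<open>If \<open>(a x\<^sup>i, b y\<^sup>i)\<close> has trivial first entry, then \<open>x\<^sup>i\<close> lies in the domain, which
  forces \<open>p dvd i\<close> because \<open>x\<close> does not; hence the pair already lies in \<open>R\<close>.\<close>

lemma adjoin_one:
  assumes p: "prime (p::nat)" and x: "x \<in> carrier G" "x \<notin> Domain R" and y: "y \<in> carrier H"
    and xy: "(x [^]\<^bsub>G\<^esub> p, y [^]\<^bsub>H\<^esub> p) \<in> R"
    and mem: "(\<one>\<^bsub>G\<^esub>, w) \<in> adjoin G H R x y"
  shows "w = \<one>\<^bsub>H\<^esub>"
proof -
  obtain a b and i :: int where ab: "(a, b) \<in> R"
    and a: "a \<otimes>\<^bsub>G\<^esub> x [^]\<^bsub>G\<^esub> i = \<one>\<^bsub>G\<^esub>" and w: "w = b \<otimes>\<^bsub>H\<^esub> y [^]\<^bsub>H\<^esub> i"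
    using mem unfolding adjoin_def by auto
  have a_carr: "a \<in> carrier G" using mem_carrier[OF ab] by simp
  have "x [^]\<^bsub>G\<^esub> i = inv\<^bsub>G\<^esub> a"
    using a a_carr x G.inv_equality[of "x [^]\<^bsub>G\<^esub> i" a] by (simp add: G.m_comm)
  then have xi: "(x [^]\<^bsub>G\<^esub> i, inv\<^bsub>H\<^esub> b) \<in> R" using inv_mem[OF ab] by simp
  have xp: "(x [^]\<^bsub>G\<^esub> int p, y [^]\<^bsub>H\<^esub> int p) \<in> R" using xy by (simp add: int_pow_int)
  have "int p dvd i"
  proof (rule ccontr)
    assume "\<not> int p dvd i"
    then have "coprime (int p) i" using p by (simp add: prime_imp_coprime)
    \<comment> \<open>Bezout writes \<open>x\<close> as a product of a power of \<open>x^p\<close>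
      and a power of \<open>x^i\<close>, both of which lie in the domain.\<close>
    then obtain u v where uv: "int p * u + i * v = 1"
      using bezout_int[of "int p" i] by (auto simp: mult.commute)
    have "x = x [^]\<^bsub>G\<^esub> (int p * u + i * v)" using x uv by simp
    also have "\<dots> = (x [^]\<^bsub>G\<^esub> int p) [^]\<^bsub>G\<^esub> u \<otimes>\<^bsub>G\<^esub> (x [^]\<^bsub>G\<^esub> i) [^]\<^bsub>G\<^esub> v"
      using x by (simp only: G.int_pow_mult G.int_pow_pow)
    finally show False
      using x(2) mult_mem[OF int_pow_mem[OF xp, of u] int_pow_mem[OF xi, of v]]
      by auto
  qed
  then obtain j where j: "i = int p * j" by (elim dvdE)
  have "(a \<otimes>\<^bsub>G\<^esub> (x [^]\<^bsub>G\<^esub> int p) [^]\<^bsub>G\<^esub> j, b \<otimes>\<^bsub>H\<^esub> (y [^]\<^bsub>H\<^esub> int p) [^]\<^bsub>H\<^esub> j) \<in> R"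
    by (intro mult_mem ab int_pow_mem xp)
  then have "(\<one>\<^bsub>G\<^esub>, w) \<in> R"
    using a w x y by (simp add: G.int_pow_pow H.int_pow_pow j)
  then show ?thesis using one_iff[of "\<one>\<^bsub>G\<^esub>" w] by simp
qed

text \<open>\<open>adjoin_one\<close> for \<open>R\<close> treats a neutral first entry, and
  \<open>adjoin_one\<close> for the converse a neutral second entry; hence the symmetric conditions
  on \<open>x\<close> and \<open>y\<close>.\<close>

lemma partial_iso_adjoin:
  assumes p: "prime (p::nat)" and x: "x \<in> carrier G" "x \<notin> Domain R"
    and y: "y \<in> carrier H" "y \<notin> Range R"
    and xy: "(x [^]\<^bsub>G\<^esub> p, y [^]\<^bsub>H\<^esub> p) \<in> R"
  shows "partial_iso G H (adjoin G H R x y)"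
proof (intro partial_iso.intro partial_iso_axioms.intro)
  interpret C: partial_iso H G "R\<inverse>" by (rule converse)
  show "subgroup (adjoin G H R x y) (G \<times>\<times> H)"
  proof (rule subgroup.intro)
    show "adjoin G H R x y \<subseteq> carrier (G \<times>\<times> H)"
      using x y mem_carrier by (auto simp: adjoin_def)
    show "\<one>\<^bsub>G \<times>\<times> H\<^esub> \<in> adjoin G H R x y"
      unfolding adjoin_def
      by (rule CollectI, intro exI[of _ "\<one>\<^bsub>G\<^esub>"] exI[of _ "\<one>\<^bsub>H\<^esub>"] exI[of _ 0]) (simp add: one_mem)
  next
    fix z w assume "z \<in> adjoin G H R x y" "w \<in> adjoin G H R x y"
    then obtain a b and i :: int and c d and j :: int where
      z: "z = (a \<otimes>\<^bsub>G\<^esub> x [^]\<^bsub>G\<^esub> i, b \<otimes>\<^bsub>H\<^esub> y [^]\<^bsub>H\<^esub> i)" "(a, b) \<in> R" and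
      w: "w = (c \<otimes>\<^bsub>G\<^esub> x [^]\<^bsub>G\<^esub> j, d \<otimes>\<^bsub>H\<^esub> y [^]\<^bsub>H\<^esub> j)" "(c, d) \<in> R"
      unfolding adjoin_def by blast
    have "z \<otimes>\<^bsub>G \<times>\<times> H\<^esub> w = ((a \<otimes>\<^bsub>G\<^esub> c) \<otimes>\<^bsub>G\<^esub> x [^]\<^bsub>G\<^esub> (i + j), (b \<otimes>\<^bsub>H\<^esub> d) \<otimes>\<^bsub>H\<^esub> y [^]\<^bsub>H\<^esub> (i + j))"
      using z w mem_carrier[OF z(2)] mem_carrier[OF w(2)] x y
      by (simp add: G.int_pow_mult H.int_pow_mult G.m_ac H.m_ac)
    then show "z \<otimes>\<^bsub>G \<times>\<times> H\<^esub> w \<in> adjoin G H R x y"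
      unfolding adjoin_def using mult_mem[OF z(2) w(2)] by blast
  next
    fix z assume "z \<in> adjoin G H R x y"
    then obtain a b and i :: int where
      z: "z = (a \<otimes>\<^bsub>G\<^esub> x [^]\<^bsub>G\<^esub> i, b \<otimes>\<^bsub>H\<^esub> y [^]\<^bsub>H\<^esub> i)" "(a, b) \<in> R"
      unfolding adjoin_def by blast
    have "inv\<^bsub>G \<times>\<times> H\<^esub> z = (inv\<^bsub>G\<^esub> a \<otimes>\<^bsub>G\<^esub> x [^]\<^bsub>G\<^esub> (- i), inv\<^bsub>H\<^esub> b \<otimes>\<^bsub>H\<^esub> y [^]\<^bsub>H\<^esub> (- i))"
      using z mem_carrier[OF z(2)] x y
      by (simp add: inv_DirProd[OF G.is_group H.is_group] G.int_pow_neg H.int_pow_neg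
          G.inv_mult H.inv_mult)
    then show "inv\<^bsub>G \<times>\<times> H\<^esub> z \<in> adjoin G H R x y"
      unfolding adjoin_def using inv_mem[OF z(2)] by blast
  qed
  show "comm_group G" "comm_group H" by (fact G.comm_group_axioms H.comm_group_axioms)+
  fix u v assume uv: "(u, v) \<in> adjoin G H R x y"
  have "v = \<one>\<^bsub>H\<^esub>" if "u = \<one>\<^bsub>G\<^esub>"
    using adjoin_one[OF p x y(1) xy] uv that by blast
  moreover have "u = \<one>\<^bsub>G\<^esub>" if "v = \<one>\<^bsub>H\<^esub>"
    using C.adjoin_one[OF p y(1) _ x(1)] y(2) xy uv that converse_adjoin[of G H R x y] by auto
  ultimately show "u = \<one>\<^bsub>G\<^esub> \<longleftrightarrow> v = \<one>\<^bsub>H\<^esub>" by blast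
qed

lemma subset_adjoin:
  assumes "x \<in> carrier G" "y \<in> carrier H" shows "R \<subseteq> adjoin G H R x y"
proof clarify
  fix a b assume ab: "(a, b) \<in> R"
  show "(a, b) \<in> adjoin G H R x y"
    unfolding adjoin_def
    using ab mem_carrier[OF ab]
    by (intro CollectI exI[of _ a] exI[of _ b] exI[of _ "0::int"]) simp
qed

lemma mem_adjoin:
  assumes "x \<in> carrier G" "y \<in> carrier H" shows "(x, y) \<in> adjoin G H R x y"
  unfolding adjoin_def
  using assms one_mem
  by (intro CollectI exI[of _ "\<one>\<^bsub>G\<^esub>"] exI[of _ "\<one>\<^bsub>H\<^esub>"] exI[of _ "1::int"]) simp

section \<open>Totality of maximal partial isomorphisms\<close>

text \<open>The \<open>p\<close>-torsion pairs of \<open>R\<close> project bijectively onto both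
  sets. By counting, torsion missing from the domain then reveals torsion missing from the
  range.\<close>

lemma card_torsion_Domain_Range:
  "card {x \<in> Domain R. x [^]\<^bsub>G\<^esub> (p::nat) = \<one>\<^bsub>G\<^esub>} = card {y \<in> Range R. y [^]\<^bsub>H\<^esub> p = \<one>\<^bsub>H\<^esub>}"
proof -
  let ?T = "{z \<in> R. fst z [^]\<^bsub>G\<^esub> p = \<one>\<^bsub>G\<^esub>}"
  have pow: "x [^]\<^bsub>G\<^esub> p = \<one>\<^bsub>G\<^esub> \<longleftrightarrow> y [^]\<^bsub>H\<^esub> p = \<one>\<^bsub>H\<^esub>" if "(x, y) \<in> R" for x y
    using one_iff[OF nat_pow_mem[OF that]] .
  have "{x \<in> Domain R. x [^]\<^bsub>G\<^esub> p = \<one>\<^bsub>G\<^esub>} = fst ` ?T" by force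
  moreover have "{y \<in> Range R. y [^]\<^bsub>H\<^esub> p = \<one>\<^bsub>H\<^esub>} = snd ` ?T" using pow by force
  moreover have "inj_on fst ?T" "inj_on snd ?T"
    using eq_iff by (auto simp: inj_on_def)
  ultimately show ?thesis by (simp add: card_image)
qed

text \<open>Otherwise some \<open>x\<close> outside the domain has its \<open>p\<close>-th power
  inside, and a matching \<open>y\<close> outside the range would give a proper extension. If the
  domain contains all \<open>p\<close>-torsion of \<open>G\<close>, divisibility of \<open>H\<close>
  supplies \<open>y\<close>; if not, \<open>x\<close> is replaced by a missing torsion element and
  \<open>y\<close> is found by counting.\<close>

lemma maximal_imp_Domain:
  assumes maximal: "\<And>S. partial_iso G H S \<Longrightarrow> R \<subseteq> S \<Longrightarrow> S = R"
    and torsion: "\<And>x. x \<in> carrier G \<Longrightarrow> \<exists>n>0. x [^]\<^bsub>G\<^esub> (n::nat) = \<one>\<^bsub>G\<^esub>"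
    and divisible: "\<And>(p::nat) y. prime p \<Longrightarrow> y \<in> carrier H \<Longrightarrow> \<exists>z\<in>carrier H. z [^]\<^bsub>H\<^esub> p = y"
    and finG: "\<And>p::nat. prime p \<Longrightarrow> finite {x \<in> carrier G. x [^]\<^bsub>G\<^esub> p = \<one>\<^bsub>G\<^esub>}"
    and finH: "\<And>p::nat. prime p \<Longrightarrow> finite {y \<in> carrier H. y [^]\<^bsub>H\<^esub> p = \<one>\<^bsub>H\<^esub>}"
    and card_eq: "\<And>p::nat. prime p \<Longrightarrow>
      card {x \<in> carrier G. x [^]\<^bsub>G\<^esub> p = \<one>\<^bsub>G\<^esub>} = card {y \<in> carrier H. y [^]\<^bsub>H\<^esub> p = \<one>\<^bsub>H\<^esub>}"
  shows "Domain R = carrier G"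
proof (rule ccontr)
  assume ne: "Domain R \<noteq> carrier G"
  have Dom: "Domain R \<subseteq> carrier G" and Ran: "Range R \<subseteq> carrier H"
    using mem_carrier by auto
  have no_ext: False
    if "prime (p::nat)" "x \<in> carrier G" "x \<notin> Domain R" "y \<in> carrier H" "y \<notin> Range R"
      "(x [^]\<^bsub>G\<^esub> p, y [^]\<^bsub>H\<^esub> p) \<in> R" for p x y
  proof -
    have "adjoin G H R x y = R"
      by (intro maximal partial_iso_adjoin[OF that] subset_adjoin that(2,4))
    then show False using mem_adjoin[OF that(2,4)] that(3) by auto
  qed
  obtain x0 where x0: "x0 \<in> carrier G" "x0 \<notin> Domain R" using ne Dom by auto
  \<comment> \<open>Dividing the least exponent that brings \<open>x0\<close> into the domain by a
    prime factor \<open>p\<close> gives a power of \<open>x0\<close> that is still outside but whose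
    \<open>p\<close>-th power is inside.\<close>
  define n where "n = (LEAST n. n > 0 \<and> x0 [^]\<^bsub>G\<^esub> (n::nat) \<in> Domain R)"
  have "\<exists>n>0. x0 [^]\<^bsub>G\<^esub> (n::nat) \<in> Domain R"
    using torsion[OF x0(1)] one_mem by (metis (no_types) DomainI)
  from LeastI_ex[OF this] have n: "n > 0" "x0 [^]\<^bsub>G\<^esub> n \<in> Domain R"
    unfolding n_def by auto
  have n_min: "x0 [^]\<^bsub>G\<^esub> m \<notin> Domain R" if "0 < m" "m < n" for m
    using that not_less_Least[of m] unfolding n_def by blast
  have "n \<noteq> 1" using n(2) x0 by auto
  then obtain p where p: "prime p" "p dvd n" using prime_factor_nat by blast
  then obtain m where m: "n = m * p" by (metis dvdE mult.commute)
  define x where "x = x0 [^]\<^bsub>G\<^esub> m"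
  have "0 < m" "m < n" using m n(1) prime_gt_1_nat[OF p(1)] by auto
  then have x: "x \<in> carrier G" "x \<notin> Domain R" unfolding x_def using n_min x0 by auto
  have "x [^]\<^bsub>G\<^esub> p \<in> Domain R"
    using n(2) x0 by (simp add: x_def G.nat_pow_pow m)
  show False
  proof (cases "{x \<in> carrier G. x [^]\<^bsub>G\<^esub> p = \<one>\<^bsub>G\<^esub>} \<subseteq> Domain R")
    case True
    obtain w where w: "(x [^]\<^bsub>G\<^esub> p, w) \<in> R" using \<open>x [^]\<^bsub>G\<^esub> p \<in> Domain R\<close> by auto
    then obtain y where y: "y \<in> carrier H" "y [^]\<^bsub>H\<^esub> p = w"
      using divisible[OF p(1)] mem_carrier by blast
    \<comment> \<open>A partner \<open>k\<close> of \<open>y\<close> would have the same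
      \<open>p\<close>-th power as \<open>x\<close>. Then \<open>x\<close> and \<open>k\<close>
      differ by \<open>p\<close>-torsion, which lies in the domain by the case assumption, and so
      would \<open>x\<close>.\<close>
    have "y \<notin> Range R"
    proof
      assume "y \<in> Range R"
      then obtain k where k: "(k, y) \<in> R" by auto
      then have kc: "k \<in> carrier G" using mem_carrier by blast
      have "k [^]\<^bsub>G\<^esub> p = x [^]\<^bsub>G\<^esub> p"
        using eq_iff[OF nat_pow_mem[OF k] w] y by simp
      then have "(x \<otimes>\<^bsub>G\<^esub> inv\<^bsub>G\<^esub> k) [^]\<^bsub>G\<^esub> p = \<one>\<^bsub>G\<^esub>"
        using x kc by (simp add: G.nat_pow_distrib G.nat_pow_inv)
      then have "x \<otimes>\<^bsub>G\<^esub> inv\<^bsub>G\<^esub> k \<in> Domain R" using True x kc by auto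
      then obtain v where v: "(x \<otimes>\<^bsub>G\<^esub> inv\<^bsub>G\<^esub> k, v) \<in> R" by auto
      have "(x, v \<otimes>\<^bsub>H\<^esub> y) \<in> R" using mult_mem[OF v k] x kc by (simp add: G.m_assoc)
      then show False using x by auto
    qed
    then show False using no_ext[OF p(1) x y(1)] w y by simp
  next
    case False
    then obtain z where z: "z \<in> carrier G" "z [^]\<^bsub>G\<^esub> p = \<one>\<^bsub>G\<^esub>" "z \<notin> Domain R" by auto
    have "card {y \<in> Range R. y [^]\<^bsub>H\<^esub> p = \<one>\<^bsub>H\<^esub>} = card {x \<in> Domain R. x [^]\<^bsub>G\<^esub> p = \<one>\<^bsub>G\<^esub>}"
      using card_torsion_Domain_Range by simp
    also have "\<dots> < card {x \<in> carrier G. x [^]\<^bsub>G\<^esub> p = \<one>\<^bsub>G\<^esub>}"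
      using z Dom by (intro psubset_card_mono finG[OF p(1)]) auto
    also have "\<dots> = card {y \<in> carrier H. y [^]\<^bsub>H\<^esub> p = \<one>\<^bsub>H\<^esub>}" by (rule card_eq[OF p(1)])
    finally have "{y \<in> carrier H. y [^]\<^bsub>H\<^esub> p = \<one>\<^bsub>H\<^esub>} \<noteq> {y \<in> Range R. y [^]\<^bsub>H\<^esub> p = \<one>\<^bsub>H\<^esub>}"
      by (metis (no_types) less_irrefl)
    moreover have "{y \<in> Range R. y [^]\<^bsub>H\<^esub> p = \<one>\<^bsub>H\<^esub>} \<subseteq> {y \<in> carrier H. y [^]\<^bsub>H\<^esub> p = \<one>\<^bsub>H\<^esub>}"
      using Ran by auto
    ultimately obtain y where y: "y \<in> carrier H" "y [^]\<^bsub>H\<^esub> p = \<one>\<^bsub>H\<^esub>" "y \<notin> Range R" by auto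
    \<comment> \<open>Both \<open>p\<close>-th powers are neutral, so they form the neutral pair,
      which is in \<open>R\<close>.\<close>
    then show False using no_ext[OF p(1) z(1) z(3) y(1) y(3)] z(2) one_mem by simp
  qed
qed

lemma is_iso_if_total:
  assumes "Domain R = carrier G" "Range R = carrier H"
  shows "G \<cong> H"
proof -
  define f where "f x = (THE y. (x, y) \<in> R)" for x
  have f_eq: "f x = y" if "(x, y) \<in> R" for x y
    unfolding f_def using eq_iff[OF that] that by (intro the_equality) auto
  have mem: "(x, f x) \<in> R" if "x \<in> carrier G" for x
    using that f_eq unfolding assms(1)[symmetric] by (auto simp: Domain_iff)
  have "f \<in> iso G H"
  proof (rule isoI)
    show "f \<in> hom G H"
    proof (rule homI)
      show "f x \<in> carrier H" if "x \<in> carrier G" for x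
        using mem_carrier[OF mem[OF that]] by simp
      show "f (x \<otimes>\<^bsub>G\<^esub> y) = f x \<otimes>\<^bsub>H\<^esub> f y" if "x \<in> carrier G" "y \<in> carrier G" for x y
        by (rule f_eq[OF mult_mem[OF mem[OF that(1)] mem[OF that(2)]]])
    qed
    show "bij_betw f (carrier G) (carrier H)"
    proof (rule bij_betw_imageI)
      show "inj_on f (carrier G)" using eq_iff[OF mem mem] by (simp add: inj_on_def)
      show "f ` carrier G = carrier H"
      proof
        show "f ` carrier G \<subseteq> carrier H" using mem_carrier[OF mem] by auto
        show "carrier H \<subseteq> f ` carrier G"
        proof
          fix y assume "y \<in> carrier H"
          then obtain x where "(x, y) \<in> R" using assms(2) by auto
          then show "y \<in> f ` carrier G" using f_eq mem_carrier by (metis image_eqI)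
        qed
      qed
    qed
  qed
  then show ?thesis by (rule is_isoI)
qed

end

text \<open>Structurally, both groups are sums of Pruefer groups with equal multiplicities. The
  decomposition is bypassed: \<open>maximal_imp_Domain\<close> is applied to a Zorn-maximal partial
  isomorphism and to its converse.\<close>

theorem divisible_torsion_group_iso:
  assumes comm: "comm_group G" "comm_group H"
    and torG: "\<And>x. x \<in> carrier G \<Longrightarrow> \<exists>n>0. x [^]\<^bsub>G\<^esub> (n::nat) = \<one>\<^bsub>G\<^esub>"
    and torH: "\<And>y. y \<in> carrier H \<Longrightarrow> \<exists>n>0. y [^]\<^bsub>H\<^esub> (n::nat) = \<one>\<^bsub>H\<^esub>"
    and divG: "\<And>(p::nat) x. prime p \<Longrightarrow> x \<in> carrier G \<Longrightarrow> \<exists>z\<in>carrier G. z [^]\<^bsub>G\<^esub> p = x"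
    and divH: "\<And>(p::nat) y. prime p \<Longrightarrow> y \<in> carrier H \<Longrightarrow> \<exists>z\<in>carrier H. z [^]\<^bsub>H\<^esub> p = y"
    and finG: "\<And>p::nat. prime p \<Longrightarrow> finite {x \<in> carrier G. x [^]\<^bsub>G\<^esub> p = \<one>\<^bsub>G\<^esub>}"
    and finH: "\<And>p::nat. prime p \<Longrightarrow> finite {y \<in> carrier H. y [^]\<^bsub>H\<^esub> p = \<one>\<^bsub>H\<^esub>}"
    and card_eq: "\<And>p::nat. prime p \<Longrightarrow>
      card {x \<in> carrier G. x [^]\<^bsub>G\<^esub> p = \<one>\<^bsub>G\<^esub>} = card {y \<in> carrier H. y [^]\<^bsub>H\<^esub> p = \<one>\<^bsub>H\<^esub>}"
  shows "G \<cong> H"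
proof -
  have "\<exists>R\<in>{R. partial_iso G H R}. \<forall>S\<in>{R. partial_iso G H R}. R \<subseteq> S \<longrightarrow> S = R"
  proof (rule subset_Zorn_nonempty)
    show "{R. partial_iso G H R} \<noteq> {}" using partial_iso_singleton[OF comm] by auto
  qed (simp add: partial_iso_Union_chain)
  then obtain R where "partial_iso G H R"
    and maximal: "\<And>S. partial_iso G H S \<Longrightarrow> R \<subseteq> S \<Longrightarrow> S = R" by blast
  then interpret R: partial_iso G H R by simp
  interpret C: partial_iso H G "R\<inverse>" by (rule R.converse)
  have "Domain R = carrier G"
    using maximal torG divH finG finH card_eq by (rule R.maximal_imp_Domain)
  \<comment> \<open>Taking converses preserves inclusion, so maximality passes to
    \<open>R\<inverse>\<close>.\<close>
  moreover have maximal': "S = R\<inverse>" if "partial_iso H G S" "R\<inverse> \<subseteq> S" for S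
  proof -
    have "S\<inverse> = R" using that(2) by (intro maximal partial_iso.converse[OF that(1)]) auto
    then show ?thesis by auto
  qed
  have "Domain (R\<inverse>) = carrier H"
    using maximal' torH divG finH finG card_eq[symmetric] by (rule C.maximal_imp_Domain)
  ultimately show ?thesis
    using R.is_iso_if_total by simp
qed

subsection \<open>Quotients by subgroups of powers\<close>

text \<open>Sending \<open>f x\<close> to \<open>g x\<close> is well defined and injective. This
  compares the sizes of sets of cosets without building a homomorphism between quotients.\<close>

lemma bij_betw_images_if_same_fibres:
  assumes "\<And>x y. x \<in> S \<Longrightarrow> y \<in> S \<Longrightarrow> f x = f y \<longleftrightarrow> g x = g y"
  shows "\<exists>h. bij_betw h (f ` S) (g ` S)"
proof -
  define h where "h = g \<circ> inv_into S f"
  have h: "h (f x) = g x" if "x \<in> S" for x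
    using assms[of "inv_into S f (f x)" x] that inv_into_into[of "f x" f S] f_inv_into_f[of "f x" f S]
    by (simp add: h_def)
  have "inj_on h (f ` S)" using assms h by (simp add: inj_on_def)
  moreover have "h ` f ` S = g ` S" using h by (simp add: image_image)
  ultimately show ?thesis by (auto simp: bij_betw_def)
qed

lemma (in group) rcos_eq_iff:
  assumes "subgroup K G" "x \<in> carrier G" "y \<in> carrier G"
  shows "K #> x = K #> y \<longleftrightarrow> x \<otimes> inv y \<in> K"
  using subgroup.rcos_module[OF assms(1) is_group assms(3,2)]
    rcos_self[OF assms(2,1)] repr_independence[OF _ assms(3,1), of x]
  by auto

text \<open>Lagrange's theorem for the kernel, combined with the first isomorphism theorem. Infinite
  orders count as 0, and the equation remains true for them.\<close>

lemma (in group_hom) order_eq_order_mult_card_kernel: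
  assumes "h ` carrier G = carrier H"
  shows "order G = order H * card (kernel G H h)"
  using G.lagrange[OF subgroup_kernel] iso_same_order[OF FactGroup_iso_set[OF assms]]
  by (simp add: order_def FactGroup_def)

definition pow_image :: "('a, 'b) monoid_scheme \<Rightarrow> nat \<Rightarrow> 'a set"
  where "pow_image G p = (\<lambda>x. x [^]\<^bsub>G\<^esub> p) ` carrier G"

lemma (in comm_group) subgroup_pow_image: "subgroup (pow_image G p) G"
proof (rule subgroupI)
  show "pow_image G p \<subseteq> carrier G" "pow_image G p \<noteq> {}"
    using one_closed by (auto simp: pow_image_def)
next
  fix a assume "a \<in> pow_image G p"
  then obtain x where "x \<in> carrier G" "a = x [^] p" by (auto simp: pow_image_def)
  then have "inv a = (inv x) [^] p" "inv x \<in> carrier G" by (simp_all add: nat_pow_inv)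
  then show "inv a \<in> pow_image G p" by (auto simp: pow_image_def)
next
  fix a b assume "a \<in> pow_image G p" "b \<in> pow_image G p"
  then obtain x y where "x \<in> carrier G" "a = x [^] p" "y \<in> carrier G" "b = y [^] p"
    by (auto simp: pow_image_def)
  then have "a \<otimes> b = (x \<otimes> y) [^] p" "x \<otimes> y \<in> carrier G" by (simp_all add: nat_pow_distrib)
  then show "a \<otimes> b \<in> pow_image G p" by (auto simp: pow_image_def)
qed

text \<open>An isomorphism matches the \<open>p\<close>-th powers of the two groups exactly, so two
  elements share a coset on one side if and only if their images do on the other.\<close>

lemma order_Mod_pow_image_iso:
  assumes "comm_group G" "comm_group H" and f: "f \<in> iso G H"
  shows "order (G Mod pow_image G p) = order (H Mod pow_image H p)"
proof -
  interpret G: comm_group G by fact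
  interpret H: comm_group H by fact
  interpret group_hom G H f
    using f G.is_group H.is_group by (auto simp: group_hom_def group_hom_axioms_def iso_def)
  have inj: "inj_on f (carrier G)" and surj: "f ` carrier G = carrier H"
    using f by (auto simp: iso_def bij_betw_def)
  have mem: "x \<in> pow_image G p \<longleftrightarrow> f x \<in> pow_image H p" if x: "x \<in> carrier G" for x
  proof -
    have "f x \<in> pow_image H p \<longleftrightarrow> (\<exists>y\<in>carrier G. f x = f (y [^]\<^bsub>G\<^esub> p))"
      by (simp add: pow_image_def hom_nat_pow image_iff flip: surj)
    also have "\<dots> \<longleftrightarrow> (\<exists>y\<in>carrier G. x = y [^]\<^bsub>G\<^esub> p)"
      using inj x by (intro bex_cong refl) (simp add: inj_on_eq_iff)
    finally show ?thesis by (auto simp: pow_image_def)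
  qed
  have "(pow_image G p #>\<^bsub>G\<^esub> x = pow_image G p #>\<^bsub>G\<^esub> y) \<longleftrightarrow>
      (pow_image H p #>\<^bsub>H\<^esub> f x = pow_image H p #>\<^bsub>H\<^esub> f y)"
    if "x \<in> carrier G" "y \<in> carrier G" for x y
    using that mem[of "x \<otimes>\<^bsub>G\<^esub> inv\<^bsub>G\<^esub> y"]
    by (simp add: G.rcos_eq_iff[OF G.subgroup_pow_image] H.rcos_eq_iff[OF H.subgroup_pow_image])
  then obtain h where "bij_betw h ((\<lambda>x. pow_image G p #>\<^bsub>G\<^esub> x) ` carrier G)
      ((\<lambda>x. pow_image H p #>\<^bsub>H\<^esub> f x) ` carrier G)"
    using bij_betw_images_if_same_fibres[of "carrier G" "\<lambda>x. pow_image G p #>\<^bsub>G\<^esub> x"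
        "\<lambda>x. pow_image H p #>\<^bsub>H\<^esub> f x"] by blast
  moreover have "(\<lambda>x. pow_image H p #>\<^bsub>H\<^esub> f x) ` carrier G = carrier (H Mod pow_image H p)"
    unfolding carrier_FactGroup surj[symmetric] by (simp add: image_image)
  ultimately show ?thesis
    unfolding order_def carrier_FactGroup[of G] by (metis bij_betw_same_card)
qed

lemma (in comm_group) subgroup_imp_comm_group:
  assumes "subgroup L G" shows "comm_group (G\<lparr>carrier := L\<rparr>)"
  using subgroup.mem_carrier[OF assms] m_comm
  by (intro group.group_comm_groupI[OF subgroup_imp_group[OF assms]]) simp

lemma (in comm_group) pow_image_subgroup:
  assumes "subgroup L G"
  shows "pow_image (G\<lparr>carrier := L\<rparr>) p = (\<lambda>x. x [^] p) ` L"
  by (simp add: pow_image_def nat_pow_consistent[symmetric])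

text \<open>The exact sequence \<open>0 \<rightarrow> (G/L)[p] \<rightarrow> L/L\<^sup>p \<rightarrow> G/G\<^sup>p \<rightarrow> 0\<close>, whose first
  map is induced by \<open>x \<mapsto> x\<^sup>p\<close>.\<close>

lemma (in comm_group) card_torsion_Mod:
  assumes L: "subgroup L G"
    and inj: "inj_on (\<lambda>x. x [^] p) (carrier G)"
    and gen: "\<And>x. x \<in> carrier G \<Longrightarrow> \<exists>l\<in>L. \<exists>y\<in>carrier G. x = l \<otimes> y [^] p"
  shows "order (G\<lparr>carrier := L\<rparr> Mod pow_image (G\<lparr>carrier := L\<rparr>) p) =
    order (G Mod pow_image G p) * card {X \<in> carrier (G Mod L). X [^]\<^bsub>G Mod L\<^esub> p = L}"
proof -
  let ?GL = "G\<lparr>carrier := L\<rparr>"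
  let ?P = "pow_image G p" and ?PL = "pow_image ?GL p"
  interpret GL: comm_group ?GL
    by (rule subgroup_imp_comm_group[OF L])
  have L_carr: "x \<in> carrier G" if "x \<in> L" for x
    using subgroup.mem_carrier[OF L that] .
  have P: "subgroup ?P G" and PL: "subgroup ?PL ?GL"
    by (rule subgroup_pow_image GL.subgroup_pow_image)+
  have PL_G: "subgroup ?PL G"
    using incl_subgroup[OF L PL] .
  have PL_sub: "?PL \<subseteq> ?P" "?PL \<subseteq> L"
  proof -
    show "?PL \<subseteq> ?P"
      unfolding pow_image_subgroup[OF L] unfolding pow_image_def using L_carr by auto
    show "?PL \<subseteq> L" using subgroup.subset[OF PL] by simp
  qed
  have normP: "?P \<lhd> G" and normPL: "?PL \<lhd> ?GL" and normL: "L \<lhd> G"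
    using P PL L by (simp_all add: normal_iff_subgroup GL.normal_iff_subgroup)
  interpret QP: group "G Mod ?P" by (rule normal.factorgroup_is_group[OF normP])
  interpret QPL: group "?GL Mod ?PL" by (rule normal.factorgroup_is_group[OF normPL])
  have coset_GL: "r_coset ?GL K x = K #> x" for K x by (simp add: r_coset_def)
  have "(\<lambda>x. ?P #> x) \<in> hom ?GL (G Mod ?P)"
    using normal.r_coset_hom_Mod[OF normP] L_carr by (auto simp: hom_def)
  then interpret h: group_hom ?GL "G Mod ?P" "\<lambda>x. ?P #> x"
    by (simp add: group_hom_def group_hom_axioms_def QP.is_group GL.is_group)
  have P_iff: "?P #> x = ?P \<longleftrightarrow> x \<in> ?P" if "x \<in> carrier G" for x
    using coset_join1[OF _ that P] coset_join2[OF that P] by auto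
  have ker: "kernel ?GL (G Mod ?P) (\<lambda>x. ?P #> x) = L \<inter> ?P"
    using P_iff L_carr by (auto simp: kernel_def)
  \<comment> \<open>The map from \<open>L\<close> to \<open>G/G^p\<close> kills \<open>L^p\<close>
    and therefore factors through \<open>L/L^p\<close>; \<open>g\<close> is the second map of the
    exact sequence.\<close>
  obtain g where g: "g \<in> hom (?GL Mod ?PL) (G Mod ?P)"
    and g_eq: "\<And>x. x \<in> L \<Longrightarrow> g (?PL #> x) = ?P #> x"
    using h.FactGroup_universal_kernel[OF normPL] PL_sub unfolding ker coset_GL by auto
  interpret g: group_hom "?GL Mod ?PL" "G Mod ?P" g
    using g by (simp add: group_hom_def group_hom_axioms_def QP.is_group QPL.is_group)
  have carr: "carrier (?GL Mod ?PL) = (\<lambda>x. ?PL #> x) ` L"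
    by (simp add: carrier_FactGroup coset_GL)
  have surj: "g ` carrier (?GL Mod ?PL) = carrier (G Mod ?P)"
  proof
    show "g ` carrier (?GL Mod ?PL) \<subseteq> carrier (G Mod ?P)" by auto
    show "carrier (G Mod ?P) \<subseteq> g ` carrier (?GL Mod ?PL)"
    proof
      fix X assume "X \<in> carrier (G Mod ?P)"
      then obtain x where x: "x \<in> carrier G" "X = ?P #> x" by (auto simp: carrier_FactGroup)
      then obtain l y where ly: "l \<in> L" "y \<in> carrier G" "x = l \<otimes> y [^] p" using gen by blast
      \<comment> \<open>By \<open>gen\<close>, every class of \<open>G/G^p\<close> has a
        representative in \<open>L\<close>.\<close>
      have "x \<otimes> inv l = y [^] p"
        using ly L_carr by (simp add: m_comm[of l "y [^] p"] m_assoc)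
      then have "?P #> x = ?P #> l"
        using rcos_eq_iff[OF P x(1) L_carr[OF ly(1)]] ly(2) by (simp add: pow_image_def)
      then show "X \<in> g ` carrier (?GL Mod ?PL)"
        using x(2) g_eq[OF ly(1)] ly(1) unfolding carr by (auto simp: image_iff intro!: bexI[of _ l])
    qed
  qed
  \<comment> \<open>\<open>T\<close> is the preimage in \<open>G\<close> of the
    \<open>p\<close>-torsion of \<open>G/L\<close>. Its \<open>p\<close>-th powers fill
    \<open>L \<inter> ?P\<close>, so the torsion and the kernel of \<open>g\<close> are both images
    of \<open>T\<close>, and only the fibres remain to be compared.\<close>
  define T where "T = {y \<in> carrier G. y [^] p \<in> L}"
  have kerg: "kernel (?GL Mod ?PL) (G Mod ?P) g = (\<lambda>y. ?PL #> y [^] p) ` T"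
  proof -
    have "kernel (?GL Mod ?PL) (G Mod ?P) g = (\<lambda>x. ?PL #> x) ` (L \<inter> ?P)"
      using g_eq P_iff L_carr by (auto simp: kernel_def carr)
    also have "L \<inter> ?P = (\<lambda>y. y [^] p) ` T" by (auto simp: T_def pow_image_def)
    finally show ?thesis by (simp add: image_image)
  qed
  have tors: "{X \<in> carrier (G Mod L). X [^]\<^bsub>G Mod L\<^esub> p = L} = (\<lambda>y. L #> y) ` T"
    using coset_join1[OF _ _ L] coset_join2[OF _ L]
    by (auto simp: T_def carrier_FactGroup normal.FactGroup_pow[OF normL])
  \<comment> \<open>As the \<open>p\<close>-th power map is injective, the powers of
    \<open>x\<close> and \<open>y\<close> differ by a \<open>p\<close>-th power from
    \<open>L\<close> exactly when \<open>x\<close> and \<open>y\<close> differ by an element of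
    \<open>L\<close>.\<close>
  have "(L #> x = L #> y) \<longleftrightarrow> (?PL #> x [^] p = ?PL #> y [^] p)" if xy: "x \<in> T" "y \<in> T" for x y
  proof -
    have carr_xy: "x \<in> carrier G" "y \<in> carrier G" using xy by (auto simp: T_def)
    then have "x [^] p \<otimes> inv (y [^] p) = (x \<otimes> inv y) [^] p"
      by (simp add: nat_pow_distrib nat_pow_inv)
    moreover have "(x \<otimes> inv y) [^] p \<in> (\<lambda>x. x [^] p) ` L \<longleftrightarrow> x \<otimes> inv y \<in> L"
      using carr_xy L_carr by (intro inj_on_image_mem_iff[OF inj]) auto
    ultimately show ?thesis
      using carr_xy rcos_eq_iff[OF PL_G, of "x [^] p" "y [^] p"]
      by (simp add: rcos_eq_iff[OF L] pow_image_subgroup[OF L])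
  qed
  then have "\<exists>h. bij_betw h ((\<lambda>y. L #> y) ` T) ((\<lambda>y. ?PL #> y [^] p) ` T)"
    by (intro bij_betw_images_if_same_fibres)
  then have "card ((\<lambda>y. L #> y) ` T) = card ((\<lambda>y. ?PL #> y [^] p) ` T)"
    by (auto dest: bij_betw_same_card)
  then show ?thesis
    using g.order_eq_order_mult_card_kernel[OF surj] unfolding kerg tors by simp
qed

text \<open>Since finitely many elements can be pushed into \<open>L\<close> by a single power of \<open>\<alpha>\<close>, the
  order of \<open>G/G\<^sup>p\<close> is at most that of \<open>L/L\<^sup>p\<close>. Pushing representatives of all its classes into
  \<open>L\<close> shows that \<open>L\<close> meets every class.\<close>

lemma (in comm_group) eventually_in_subgroup_imp_generates_mod_pow:
  assumes L: "subgroup L G"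
    and iso: "\<alpha> \<in> iso G G" and \<alpha>L: "\<alpha> ` L \<subseteq> L"
    and ev: "\<And>x. x \<in> carrier G \<Longrightarrow> \<exists>n. (\<alpha> ^^ n) x \<in> L"
    and fin: "finite (carrier (G\<lparr>carrier := L\<rparr> Mod pow_image (G\<lparr>carrier := L\<rparr>) p))"
    and x: "x \<in> carrier G"
  shows "\<exists>l\<in>L. \<exists>y\<in>carrier G. x = l \<otimes> y [^] p"
proof -
  let ?GL = "G\<lparr>carrier := L\<rparr>"
  let ?P = "pow_image G p" and ?PL = "pow_image ?GL p"
  have L_carr: "x \<in> carrier G" if "x \<in> L" for x
    using subgroup.mem_carrier[OF L that] .
  interpret GL: comm_group ?GL
    by (rule subgroup_imp_comm_group[OF L])
  have P: "subgroup ?P G" by (rule subgroup_pow_image)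
  have PL: "subgroup ?PL G" using incl_subgroup[OF L GL.subgroup_pow_image] .
  have iso_n: "\<alpha> ^^ n \<in> iso G G" for n
  proof (induction n)
    case 0
    then show ?case using iso_set_refl by (simp add: id_def)
  next
    case (Suc n)
    then show ?case using iso_set_trans[OF Suc iso] by (simp add: o_def)
  qed
  have hom_n: "group_hom G G (\<alpha> ^^ n)" for n
    using iso_n[of n] by (simp add: group_hom_def group_hom_axioms_def iso_def is_group)
  have inj_n: "inj_on (\<alpha> ^^ n) (carrier G)" and surj_n: "(\<alpha> ^^ n) ` carrier G = carrier G" for n
    using iso_n[of n] by (auto simp: iso_def bij_betw_def)
  have stay: "(\<alpha> ^^ n) y \<in> L" if "y \<in> L" for n y
    using that \<alpha>L by (induction n) auto
  \<comment> \<open>Because \<open>\<alpha>\<close> maps \<open>L\<close> into itself, exponents may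
    be increased freely, and the sum of two exponents serves both.\<close>
  have common: "\<exists>n. \<forall>y\<in>R. (\<alpha> ^^ n) y \<in> L" if "finite R" "R \<subseteq> carrier G" for R
    using that
  proof (induction R rule: finite_induct)
    case (insert r R)
    then obtain n where n: "\<forall>y\<in>R. (\<alpha> ^^ n) y \<in> L" by auto
    obtain m where m: "(\<alpha> ^^ m) r \<in> L" using ev insert.prems by auto
    have "(\<alpha> ^^ (m + n)) y \<in> L" if "y \<in> R" for y
      using stay[of "(\<alpha> ^^ n) y" m] n that by (simp add: funpow_add)
    moreover have "(\<alpha> ^^ (m + n)) r \<in> L"
      using stay[OF m, of n] by (simp add: add.commute[of m n] funpow_add)
    ultimately show ?case by auto
  qed simp
  \<comment> \<open>Finite sets of classes have uniformly bounded size: their representatives,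
    pushed into \<open>L\<close>, stay distinct modulo \<open>?PL\<close>.\<close>
  have "finite (carrier (G Mod ?P)) \<and> card (carrier (G Mod ?P)) \<le> card (carrier (?GL Mod ?PL))"
  proof (rule finite_if_finite_subsets_card_bdd)
    fix F assume F: "F \<subseteq> carrier (G Mod ?P)" "finite F"
    have "\<exists>R\<subseteq>carrier G. inj_on (\<lambda>x. ?P #> x) R \<and> F = (\<lambda>x. ?P #> x) ` R"
      using F(1) unfolding carrier_FactGroup subset_image_inj .
    then obtain R where R: "R \<subseteq> carrier G" "inj_on (\<lambda>x. ?P #> x) R" "F = (\<lambda>x. ?P #> x) ` R"
      by (elim exE conjE)
    then have "finite R" using F(2) by (simp add: finite_image_iff)
    from common[OF this R(1)] obtain n where n: "\<forall>y\<in>R. (\<alpha> ^^ n) y \<in> L" ..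
    interpret n: group_hom G G "\<alpha> ^^ n" by (rule hom_n)
    have "inj_on (\<lambda>y. ?PL #> (\<alpha> ^^ n) y) R"
    proof (rule inj_onI)
      fix y z assume yz: "y \<in> R" "z \<in> R" and eq: "?PL #> (\<alpha> ^^ n) y = ?PL #> (\<alpha> ^^ n) z"
      then have yz': "y \<in> carrier G" "z \<in> carrier G" using R(1) by auto
      have "(\<alpha> ^^ n) (y \<otimes> inv z) \<in> ?PL"
        using eq yz' by (simp add: rcos_eq_iff[OF PL])
      then obtain l where l: "l \<in> L" "(\<alpha> ^^ n) (y \<otimes> inv z) = l [^] p"
        by (auto simp: pow_image_subgroup[OF L])
      \<comment> \<open>The root \<open>l\<close> is itself a value of the automorphism, so the
        congruence modulo \<open>?PL\<close> pulls back to one modulo \<open>?P\<close>, where the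
        elements of \<open>R\<close> are distinct.\<close>
      have "l \<in> (\<alpha> ^^ n) ` carrier G" using L_carr[OF l(1)] surj_n[of n] by simp
      then obtain w where w: "w \<in> carrier G" "l = (\<alpha> ^^ n) w" by auto
      have "(\<alpha> ^^ n) (y \<otimes> inv z) = (\<alpha> ^^ n) (w [^] p)"
        using l(2) w by (simp add: n.hom_nat_pow)
      then have "y \<otimes> inv z = w [^] p"
        by (rule inj_onD[OF inj_n[of n]]) (simp_all add: yz' w(1))
      then have "?P #> y = ?P #> z"
        using rcos_eq_iff[OF P yz'] w(1) by (simp add: pow_image_def)
      then show "y = z" using R(2) yz by (simp add: inj_on_eq_iff)
    qed
    moreover have "(\<lambda>y. ?PL #> (\<alpha> ^^ n) y) ` R \<subseteq> carrier (?GL Mod ?PL)"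
      using n by (auto simp: carrier_FactGroup r_coset_def)
    ultimately have "card R \<le> card (carrier (?GL Mod ?PL))" using fin card_inj_on_le by blast
    then show "card F \<le> card (carrier (?GL Mod ?PL))" using R by (simp add: card_image)
  qed
  then have "\<exists>R\<subseteq>carrier G. finite R \<and> carrier (G Mod ?P) = (\<lambda>x. ?P #> x) ` R"
    by (intro finite_subset_image) (simp_all add: carrier_FactGroup)
  then obtain R where R: "R \<subseteq> carrier G" "finite R" "carrier (G Mod ?P) = (\<lambda>x. ?P #> x) ` R"
    by (elim exE conjE)
  from common[OF R(2,1)] obtain n where n: "\<forall>y\<in>R. (\<alpha> ^^ n) y \<in> L" ..
  interpret n: group_hom G G "\<alpha> ^^ n" by (rule hom_n)
  \<comment> \<open>The preimage \<open>y\<close> of \<open>x\<close> is compared with its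
    representative \<open>r\<close>. Applying \<open>\<alpha> ^^ n\<close> to
    \<open>y = r z^p\<close> returns \<open>x\<close>, now with the first factor in
    \<open>L\<close>.\<close>
  have "x \<in> (\<alpha> ^^ n) ` carrier G" using x surj_n[of n] by simp
  then obtain y where y: "y \<in> carrier G" "x = (\<alpha> ^^ n) y" by auto
  have "?P #> y \<in> (\<lambda>x. ?P #> x) ` R"
    using y(1) unfolding R(3)[symmetric] by (auto simp: carrier_FactGroup)
  then obtain r where r: "r \<in> R" "?P #> y = ?P #> r" by auto
  then have rc: "r \<in> carrier G" using R by auto
  obtain z where z: "z \<in> carrier G" "y \<otimes> inv r = z [^] p"
    using r(2) rcos_eq_iff[OF P y(1) rc] by (auto simp: pow_image_def)
  have "y = r \<otimes> z [^] p"
    unfolding z(2)[symmetric] using y(1) rc by (simp add: m_comm[of y "inv r"] flip: m_assoc)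
  then have "x = (\<alpha> ^^ n) r \<otimes> ((\<alpha> ^^ n) z) [^] p"
    using y rc z(1) by (simp add: n.hom_nat_pow)
  then show ?thesis using bspec[OF n r(1)] n.hom_closed[OF z(1)] by auto
qed

subsection \<open>Lattices\<close>

lemma vgroup_nat_pow: "x [^]\<^bsub>vgroup S\<^esub> (n::nat) = of_nat n *s x"
  by (induction n) (simp_all add: vector_sadd_rdistrib add.commute)

lemma vgroup_inv:
  assumes "group (vgroup S)" "x \<in> S"
  shows "inv\<^bsub>vgroup S\<^esub> x = - x"
  using group.l_inv[OF assms(1), of x] assms(2) by (simp add: eq_neg_iff_add_eq_0)

lemma vgroup_int_pow:
  assumes "group (vgroup S)" "x \<in> S"
  shows "x [^]\<^bsub>vgroup S\<^esub> (k::int) = of_int k *s x"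
proof (cases "k < 0")
  case True
  have "x [^]\<^bsub>vgroup S\<^esub> nat (- k) \<in> S"
    using monoid.nat_pow_closed[OF group.is_monoid[OF assms(1)], of x "nat (- k)"] assms(2) by simp
  then have "x [^]\<^bsub>vgroup S\<^esub> k = - (of_nat (nat (- k)) *s x)"
    using True vgroup_inv[OF assms(1)] by (simp only: int_pow_def2[of _ x k] vgroup_nat_pow if_True)
  then show ?thesis using True by (simp add: vec_eq_iff)
qed (simp add: int_pow_def2[of _ x k] vgroup_nat_pow)

lemma vgroup_update_carrier: "(vgroup G)\<lparr>carrier := S\<rparr> = vgroup S"
  by (simp add: vgroup_def)

section \<open>Integral bases and rational independence\<close>

text \<open>The basis consists of the images of the generators \<open>frag_of i\<close> under an
  isomorphism from the free group. Its injectivity gives independence over the integers.\<close>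

lemma free_Abelian_lattice_basis:
  fixes L :: "(rat ^ 'n) set" and I :: "'i set"
  assumes grp: "group (vgroup L)" and free: "vgroup L \<cong> free_Abelian_group I" and I: "finite I"
  shows "\<exists>e. L = range (\<lambda>c::'i \<Rightarrow> int. \<Sum>i\<in>I. of_int (c i) *s e i) \<and>
    (\<forall>c::'i \<Rightarrow> int. (\<Sum>i\<in>I. of_int (c i) *s e i) = 0 \<longrightarrow> (\<forall>i\<in>I. c i = 0))"
proof -
  let ?F = "free_Abelian_group I"
  obtain g where g: "g \<in> iso ?F (vgroup L)"
    using group.iso_sym[OF grp free] by (auto simp: is_iso_def)
  then interpret g: group_hom ?F "vgroup L" g
    using grp by (simp add: group_hom_def group_hom_axioms_def iso_def)
  have inj: "inj_on g (carrier ?F)" and surj: "g ` carrier ?F = L"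
    using g by (auto simp: iso_def bij_betw_def)
  define e where "e i = g (frag_of i)" for i
  define y where "y J c = (\<Sum>i\<in>J. frag_cmul (c i) (frag_of i))" for J and c :: "'i \<Rightarrow> int"
  have keys_y: "y J c \<in> carrier ?F" if "J \<subseteq> I" for J c
    unfolding y_def using that by (intro sum_closed_free_Abelian_group) auto
  have g_cmul: "g (frag_cmul k (frag_of i)) = of_int k *s e i" if "i \<in> I" for k i
    using g.hom_int_pow[of "frag_of i" k] vgroup_int_pow[OF grp, of "g (frag_of i)" k]
      g.hom_closed[of "frag_of i"] that
    by (simp add: e_def)
  have g_y: "g (y J c) = (\<Sum>i\<in>J. of_int (c i) *s e i)" if "J \<subseteq> I" for J c
    using finite_subset[OF that I] that
  proof (induction J rule: finite_induct)
    case empty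
    then show ?case using g.hom_one by (simp add: y_def)
  next
    case (insert i J)
    have "y (insert i J) c = frag_cmul (c i) (frag_of i) + y J c"
      using insert.hyps by (simp add: y_def)
    moreover have "frag_cmul (c i) (frag_of i) \<in> carrier ?F" "y J c \<in> carrier ?F"
      using insert.prems keys_y by auto
    ultimately have "g (y (insert i J) c) = g (frag_cmul (c i) (frag_of i)) + g (y J c)"
      using g.hom_mult by (metis mult_free_Abelian_group vgroup_simps(2))
    then show ?case using insert g_cmul by simp
  qed
  have lookup_y: "Poly_Mapping.lookup (y I c) i = (if i \<in> I then c i else 0)" for c i
    using I by (simp add: y_def lookup_sum lookup_single when_def if_distrib[of "(*) _"] cong: if_cong)
  show ?thesis
  proof (intro exI[of _ e] conjI allI impI)
    show "L = range (\<lambda>c::'i \<Rightarrow> int. \<Sum>i\<in>I. of_int (c i) *s e i)"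
    proof
      show "L \<subseteq> range (\<lambda>c::'i \<Rightarrow> int. \<Sum>i\<in>I. of_int (c i) *s e i)"
      proof
        fix x assume "x \<in> L"
        then obtain z where z: "z \<in> carrier ?F" "x = g z" unfolding surj[symmetric] by auto
        \<comment> \<open>\<open>z\<close> is rebuilt from its own coefficients, which vanish
          outside \<open>I\<close>.\<close>
        have "z = y I (Poly_Mapping.lookup z)"
          using z(1) by (intro poly_mapping_eqI) (auto simp: lookup_y in_keys_iff)
        then show "x \<in> range (\<lambda>c::'i \<Rightarrow> int. \<Sum>i\<in>I. of_int (c i) *s e i)"
          using g_y[of I "Poly_Mapping.lookup z"] z(2) by auto
      qed
      show "range (\<lambda>c::'i \<Rightarrow> int. \<Sum>i\<in>I. of_int (c i) *s e i) \<subseteq> L"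
      proof clarify
        fix c :: "'i \<Rightarrow> int"
        show "(\<Sum>i\<in>I. of_int (c i) *s e i) \<in> L"
          using g.hom_closed[OF keys_y[of I c]] g_y[of I c] by simp
      qed
    qed
  next
    fix c :: "'i \<Rightarrow> int" assume "(\<Sum>i\<in>I. of_int (c i) *s e i) = 0"
    then have "g (y I c) = g 0" using g_y[of I c] g.hom_one by simp
    then have "y I c = 0"
      using inj_onD[OF inj, of "y I c" 0] keys_y[of I c] by simp
    then show "\<forall>i\<in>I. c i = 0" using lookup_y[of c] by (metis lookup_zero)
  qed
qed

text \<open>Multiplying the denominators one index at a time gives \<open>d\<close>. It serves to
  turn rational combinations of lattice vectors into integer ones.\<close>

lemma common_denominator:
  fixes u :: "'i \<Rightarrow> rat"
  assumes "finite I"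
  shows "\<exists>d c. d > 0 \<and> (\<forall>i\<in>I. of_nat (d::nat) * u i = of_int (c i))"
proof -
  have "\<exists>d>0. \<forall>i\<in>I. of_nat (d::nat) * u i \<in> \<int>"
    using assms
  proof (induction I rule: finite_induct)
    case empty
    then show ?case by (intro exI[of _ 1]) simp
  next
    case (insert j I)
    then obtain d where d: "d > 0" "\<forall>i\<in>I. of_nat (d::nat) * u i \<in> \<int>" by auto
    obtain a b where ab: "u j = of_int a / of_int b" "b > 0"
      by (cases "u j") (auto simp: Fract_of_int_quotient)
    have "of_nat (d * nat b) * u i \<in> \<int>" if "i \<in> insert j I" for i
    proof (cases "i = j")
      case True
      then have "of_nat (d * nat b) * u i = of_int (int d * a)" using ab by simp
      then show ?thesis by (simp only: Ints_of_int)
    next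
      case False
      then have "i \<in> I" using that by simp
      with d(2) have "of_nat d * u i \<in> \<int>" by (rule bspec)
      then have "of_nat (nat b) * (of_nat d * u i) \<in> \<int>" by (rule Ints_mult[OF Ints_of_nat])
      moreover have "of_nat (d * nat b) * u i = of_nat (nat b) * (of_nat d * u i)"
        by (simp only: of_nat_mult ac_simps)
      ultimately show ?thesis by (simp only:)
    qed
    then show ?case using d(1) ab(2) by (intro exI[of _ "d * nat b"]) auto
  qed
  then obtain d where d: "d > 0" "\<And>i. i \<in> I \<Longrightarrow> of_nat (d::nat) * u i \<in> \<int>" by auto
  have "of_nat d * u i = of_int \<lfloor>of_nat d * u i\<rfloor>" if "i \<in> I" for i
    using d(2)[OF that] by (auto elim!: Ints_cases simp only: floor_of_int)
  with d(1) show ?thesis by (intro exI[of _ d] exI[of _ "\<lambda>i. \<lfloor>of_nat d * u i\<rfloor>"]) auto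
qed

text \<open>A rational relation times a common denominator is an integer relation. Injectivity is
  recorded separately, since independence of the image set does not see repeated vectors.\<close>

lemma int_independent_imp_independent:
  fixes e :: "'i \<Rightarrow> rat ^ 'n"
  assumes I: "finite I"
    and indep: "\<forall>c::'i \<Rightarrow> int. (\<Sum>i\<in>I. of_int (c i) *s e i) = 0 \<longrightarrow> (\<forall>i\<in>I. c i = 0)"
  shows "inj_on e I" and "vec.independent (e ` I)"
proof -
  have zero: "u i = 0" if "(\<Sum>i\<in>I. u i *s e i) = 0" "i \<in> I" for u :: "'i \<Rightarrow> rat" and i
  proof -
    obtain d :: nat and c :: "'i \<Rightarrow> int" where
      dc: "d > 0" "\<forall>i\<in>I. of_nat d * u i = of_int (c i)"
      using common_denominator[OF I, of u] by (elim exE conjE)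
    have "(\<Sum>i\<in>I. of_int (c i) *s e i) = (\<Sum>i\<in>I. of_nat d *s (u i *s e i))"
      by (intro sum.cong refl) (simp add: bspec[OF dc(2), symmetric] vector_smult_assoc)
    also have "\<dots> = of_nat d *s (\<Sum>i\<in>I. u i *s e i)" by (simp add: vec.scale_sum_right)
    finally have "\<forall>i\<in>I. c i = 0" using that(1) by (intro indep[THEN spec, THEN mp]) simp
    then show ?thesis using dc(1) bspec[OF dc(2) that(2)] that(2) by simp
  qed
  show inj: "inj_on e I"
  proof (rule inj_onI, rule ccontr)
    fix i j assume ij: "i \<in> I" "j \<in> I" "e i = e j" "i \<noteq> j"
    \<comment> \<open>Coefficients 1 at \<open>i\<close> and -1 at \<open>j\<close> would form a
      nontrivial relation.\<close>
    let ?u = "\<lambda>k. (if k = i then 1 else 0) - (if k = j then 1 else 0) :: rat"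
    have "(\<Sum>k\<in>I. ?u k *s e k) =
        (\<Sum>k\<in>I. if k = i then e k else 0) - (\<Sum>k\<in>I. if k = j then e k else 0)"
      unfolding sum_subtractf[symmetric] by (intro sum.cong refl) auto
    also have "\<dots> = 0" using I ij by simp
    finally show False using zero[of ?u i] ij by simp
  qed
  have "\<forall>v\<in>e ` I. w v = 0" if "(\<Sum>v\<in>e ` I. w v *s v) = 0" for w
    using that zero[of "\<lambda>i. w (e i)"] by (simp add: sum.reindex[OF inj] o_def)
  then show "vec.independent (e ` I)" using I by (auto simp: vec.dependent_finite)
qed

lemma free_Abelian_rank_le:
  fixes L :: "(rat ^ 'n) set"
  assumes "group (vgroup L)" "vgroup L \<cong> free_Abelian_group I" "finite I"
  shows "card I \<le> CARD('n)"
proof -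
  obtain e where L: "L = range (\<lambda>c. \<Sum>i\<in>I. of_int (c i) *s e i)"
    and e: "\<forall>c. (\<Sum>i\<in>I. of_int (c i) *s e i) = 0 \<longrightarrow> (\<forall>i\<in>I. c i = 0)"
    using free_Abelian_lattice_basis[OF assms] by (elim exE conjE)
  note indep = int_independent_imp_independent[OF assms(3) e]
  have "card (e ` I) \<le> vec.dim (UNIV :: (rat ^ 'n) set)"
    by (rule vec.independent_card_le_dim[OF subset_UNIV indep(2)])
  moreover have "card (e ` I) = card I" by (rule card_image[OF indep(1)])
  ultimately show ?thesis unfolding vec_dim_card by (simp only:)
qed

text \<open>As many independent vectors as the dimension span the whole space. Clearing the
  denominators of the coordinates of \<open>x\<close> moves a multiple into the lattice.\<close>

lemma full_rank_lattice_multiple_mem: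
  fixes L :: "(rat ^ 'n) set"
  assumes "group (vgroup L)" "vgroup L \<cong> free_Abelian_group I" "finite I" "card I = CARD('n)"
  shows "\<exists>d>0. of_nat (d::nat) *s x \<in> L"
proof -
  obtain e where L: "L = range (\<lambda>c. \<Sum>i\<in>I. of_int (c i) *s e i)"
    and e: "\<forall>c. (\<Sum>i\<in>I. of_int (c i) *s e i) = 0 \<longrightarrow> (\<forall>i\<in>I. c i = 0)"
    using free_Abelian_lattice_basis[OF assms(1-3)] by (elim exE conjE)
  note indep = int_independent_imp_independent[OF assms(3) e]
  have "UNIV \<subseteq> vec.span (e ` I)"
    by (rule vec.card_ge_dim_independent[OF subset_UNIV indep(2)])
      (simp only: card_image[OF indep(1)] vec_dim_card assms(4) order_refl)
  then have "x \<in> vec.span (e ` I)" by auto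
  then obtain w where "x = (\<Sum>v\<in>e ` I. w v *s v)"
    using assms(3) by (auto simp: vec.span_finite)
  then have x: "x = (\<Sum>i\<in>I. w (e i) *s e i)" by (simp add: sum.reindex[OF indep(1)])
  obtain d :: nat and c where dc: "d > 0" "\<forall>i\<in>I. of_nat d * w (e i) = of_int (c i)"
    using common_denominator[OF assms(3), of "\<lambda>i. w (e i)"] by (elim exE conjE)
  have "of_nat d *s x = (\<Sum>i\<in>I. of_int (c i) *s e i)"
    unfolding x by (simp add: vec.scale_sum_right vector_smult_assoc bspec[OF dc(2), symmetric])
  then show ?thesis using dc(1) unfolding L by auto
qed

text \<open>Reducing integer coordinates modulo \<open>p\<close> leaves finitely many
  representatives.\<close>

lemma finite_free_Abelian_Mod_pow_image:
  fixes L :: "(rat ^ 'n) set"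
  assumes comm: "comm_group (vgroup L)" and free: "vgroup L \<cong> free_Abelian_group I"
    and I: "finite I" and p: "p > 0"
  shows "finite (carrier (vgroup L Mod pow_image (vgroup L) p))"
proof -
  interpret comm_group "vgroup L" by fact
  obtain e where L: "L = range (\<lambda>c. \<Sum>i\<in>I. of_int (c i) *s e i)"
    and e: "\<forall>c. (\<Sum>i\<in>I. of_int (c i) *s e i) = 0 \<longrightarrow> (\<forall>i\<in>I. c i = 0)"
    using free_Abelian_lattice_basis[OF is_group free I] by (elim exE conjE)
  define s where "s c = (\<Sum>i\<in>I. of_int (c i) *s e i)" for c
  let ?P = "pow_image (vgroup L) p"
  let ?q = "\<lambda>x. r_coset (vgroup L) ?P x"
  let ?R = "\<Pi>\<^sub>E i\<in>I. {0..<int p}"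
  have "carrier (vgroup L Mod ?P) \<subseteq> (\<lambda>c. ?q (s c)) ` ?R"
  proof
    fix X assume "X \<in> carrier (vgroup L Mod ?P)"
    then obtain x where x: "x \<in> L" "X = ?q x" by (auto simp: carrier_FactGroup)
    then obtain c where c: "x = s c" unfolding L s_def by auto
    \<comment> \<open>The restriction puts \<open>r\<close> into the finite set \<open>?R\<close>;
      \<open>s\<close> only reads coordinates in \<open>I\<close>.\<close>
    define r where "r = restrict (\<lambda>i. c i mod int p) I"
    have "s c - s r = (\<Sum>i\<in>I. of_nat p *s (of_int (c i div int p) *s e i))"
      unfolding s_def sum_subtractf[symmetric]
    proof (intro sum.cong refl)
      fix i assume "i \<in> I"
      have "of_int (c i) = (of_nat p * of_int (c i div int p) + of_int (c i mod int p) :: rat)"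
        by (metis mult_div_mod_eq of_int_add of_int_mult of_int_of_nat_eq)
      then show "of_int (c i) *s e i - of_int (r i) *s e i =
          of_nat p *s (of_int (c i div int p) *s e i)"
        using \<open>i \<in> I\<close> by (simp add: r_def vector_smult_assoc vector_sadd_rdistrib)
    qed
    then have "s c - s r = of_nat p *s s (\<lambda>i. c i div int p)"
      by (simp add: s_def vec.scale_sum_right)
    moreover have mem: "s c' \<in> L" for c' unfolding L s_def by auto
    ultimately have "s c \<otimes>\<^bsub>vgroup L\<^esub> inv\<^bsub>vgroup L\<^esub> s r \<in> ?P"
      by (auto simp: pow_image_def vgroup_nat_pow vgroup_inv[OF is_group])
    then have "?q x = ?q (s r)"
      using rcos_eq_iff[OF subgroup_pow_image, of "s c" "s r"] mem c by simp
    moreover have "r \<in> ?R" using p by (auto simp: r_def)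
    ultimately show "X \<in> (\<lambda>c. ?q (s c)) ` ?R" using x(2) by auto
  qed
  moreover have "finite ?R" using I by (intro finite_PiE) auto
  ultimately show ?thesis using finite_surj by blast
qed

subsection \<open>Invariant lattices in dimension groups\<close>

text \<open>A point belongs to the union exactly when some iterate of the matrix takes it into
  \<open>L\<close>. This survives undoing one application and, by invariance of \<open>L\<close>,
  adding one, so the matrix and its inverse both preserve the union.\<close>

lemma rat_matrix_iso:
  assumes det: "det A \<noteq> 0" and AL: "(*v) (rat_matrix A) ` L \<subseteq> L"
  shows "(*v) (rat_matrix A) \<in> iso (vgroup (inverse_images A L)) (vgroup (inverse_images A L))"
proof -
  let ?f = "(*v) (rat_matrix A)" and ?g = "(*v) (matrix_inv (rat_matrix A))"
  let ?G = "inverse_images A L"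
  have fg: "?f (?g x) = x" and gf: "?g (?f x) = x" for x
    by (simp_all add: matrix_vector_mul_assoc rat_matrix_inverse[OF det])
  have mem: "x \<in> ?G \<longleftrightarrow> (\<exists>n. (?f ^^ n) x \<in> L)" for x
    by (rule mem_inverse_images_iff[OF det])
  have f_mem: "?f x \<in> ?G \<longleftrightarrow> x \<in> ?G" for x
  proof
    assume "?f x \<in> ?G"
    then obtain n where "(?f ^^ n) (?f x) \<in> L" using mem by auto
    then have "(?f ^^ Suc n) x \<in> L" by (simp only: funpow_Suc_right o_apply)
    then show "x \<in> ?G" using mem by blast
  next
    assume "x \<in> ?G"
    then obtain n where "(?f ^^ n) x \<in> L" using mem by auto
    then have "?f ((?f ^^ n) x) \<in> L" using AL by auto
    then have "(?f ^^ n) (?f x) \<in> L" by (simp only: funpow_swap1)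
    then show "?f x \<in> ?G" using mem by blast
  qed
  show ?thesis
  proof (rule isoI)
    show "?f \<in> hom (vgroup ?G) (vgroup ?G)"
      by (rule homI) (simp_all add: f_mem matrix_vector_right_distrib)
    show "bij_betw ?f (carrier (vgroup ?G)) (carrier (vgroup ?G))"
    proof (rule bij_betw_byWitness[where f' = ?g])
      show "?g ` carrier (vgroup ?G) \<subseteq> carrier (vgroup ?G)"
        using f_mem[of "?g x" for x] by (auto simp: fg)
    qed (auto simp: fg gf f_mem)
  qed
qed

text \<open>One side of the data of the theorem, to be instantiated with \<open>A\<close>,
  \<open>L\<close> and with \<open>B\<close>, \<open>L'\<close>.\<close>

locale invariant_lattice =
  fixes A :: "int ^ 'n ^ 'n" and L :: "(rat ^ 'n) set"
  assumes det: "det A \<noteq> 0"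
    and lattice: "lattice_of_rank CARD('n) (dimension_group A) L"
    and invariant: "(*v) (rat_matrix A) ` L \<subseteq> L"
    and exhausts: "inverse_images A L = dimension_group A"
begin

abbreviation "G \<equiv> vgroup (dimension_group A)"

sublocale comm_group G
  by (rule comm_group_dimension_group[OF det])

lemma subgroup_L: "subgroup L G"
  using lattice by (simp add: lattice_of_rank_def)

lemma free_L: "vgroup L \<cong> free_Abelian_group {..<CARD('n)}"
  using lattice by (simp add: lattice_of_rank_def)

lemma comm_group_L: "comm_group (vgroup L)"
  using subgroup_imp_comm_group[OF subgroup_L] by (simp add: vgroup_update_carrier)

lemma group_L: "group (vgroup L)"
  by (rule comm_group.axioms(2)[OF comm_group_L])

lemma normal_L: "L \<lhd> G"
  using subgroup_L by (simp add: normal_iff_subgroup)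

lemma finite_L_Mod: "p > 0 \<Longrightarrow> finite (carrier (vgroup L Mod pow_image (vgroup L) p))"
  by (rule finite_free_Abelian_Mod_pow_image[OF comm_group_L free_L finite_lessThan])

text \<open>The pushing argument with the matrix as automorphism: \<open>exhausts\<close> says that
  each element eventually enters \<open>L\<close>, and \<open>L/pL\<close> is finite.\<close>

lemma generates_mod_pow:
  assumes "(p::nat) > 0" "x \<in> carrier G"
  shows "\<exists>l\<in>L. \<exists>y\<in>carrier G. x = l \<otimes>\<^bsub>G\<^esub> y [^]\<^bsub>G\<^esub> p"
proof (rule eventually_in_subgroup_imp_generates_mod_pow[OF subgroup_L _ invariant])
  show "(*v) (rat_matrix A) \<in> iso G G"
    using rat_matrix_iso[OF det invariant] by (simp only: exhausts)
  show "\<exists>n. ((*v) (rat_matrix A) ^^ n) x \<in> L" if "x \<in> carrier G" for x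
    using that mem_inverse_images_iff[OF det, of x L] by (simp only: exhausts vgroup_simps)
qed (use assms finite_L_Mod in \<open>simp_all only: vgroup_update_carrier\<close>)

text \<open>Full rank of \<open>L\<close> puts a positive multiple of every vector into
  \<open>L\<close>.\<close>

lemma torsion_Mod:
  assumes "X \<in> carrier (G Mod L)"
  shows "\<exists>n>0. X [^]\<^bsub>G Mod L\<^esub> (n::nat) = \<one>\<^bsub>G Mod L\<^esub>"
proof -
  obtain x where x: "x \<in> carrier G" "X = L #>\<^bsub>G\<^esub> x"
    using assms by (auto simp: carrier_FactGroup)
  obtain n where n: "n > 0" "of_nat n *s x \<in> L"
    using full_rank_lattice_multiple_mem[OF group_L free_L, of x] by auto
  then have "L #>\<^bsub>G\<^esub> (x [^]\<^bsub>G\<^esub> n) = L"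
    using x(1) by (intro coset_join2[OF nat_pow_closed subgroup_L]) (simp_all add: vgroup_nat_pow)
  then show ?thesis
    using n(1) normal.FactGroup_pow[OF normal_L x(1), of n] x(2) by auto
qed

text \<open>From \<open>G = L + pG\<close>: the \<open>L\<close>-part disappears in the quotient,
  leaving a \<open>p\<close>-fold multiple.\<close>

lemma divisible_Mod:
  assumes "(p::nat) > 0" "X \<in> carrier (G Mod L)"
  shows "\<exists>Z\<in>carrier (G Mod L). Z [^]\<^bsub>G Mod L\<^esub> p = X"
proof -
  obtain x where x: "x \<in> carrier G" "X = L #>\<^bsub>G\<^esub> x"
    using assms by (auto simp: carrier_FactGroup)
  obtain l y where ly: "l \<in> L" "y \<in> carrier G" "x = l \<otimes>\<^bsub>G\<^esub> y [^]\<^bsub>G\<^esub> p"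
    using generates_mod_pow[OF assms(1) x(1)] by blast
  have l: "l \<in> carrier G" using subgroup.mem_carrier[OF subgroup_L ly(1)] .
  have yp: "y [^]\<^bsub>G\<^esub> p \<in> carrier G" using ly(2) by (rule nat_pow_closed)
  have "x \<in> L #>\<^bsub>G\<^esub> (y [^]\<^bsub>G\<^esub> p)"
    unfolding ly(3) by (rule rcosI[OF ly(1) subgroup.subset[OF subgroup_L] yp])
  then have "(L #>\<^bsub>G\<^esub> y) [^]\<^bsub>G Mod L\<^esub> p = X"
    using repr_independence[OF _ yp subgroup_L] normal.FactGroup_pow[OF normal_L ly(2), of p] x(2)
    by metis
  then show ?thesis using ly(2) by (auto simp: carrier_FactGroup)
qed

text \<open>The exact sequence applies since multiplication by \<open>p\<close> is injective on
  rational vectors.\<close>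

lemma card_torsion:
  assumes "(p::nat) > 0"
  shows "order (vgroup L Mod pow_image (vgroup L) p) =
    order (G Mod pow_image G p) * card {X \<in> carrier (G Mod L). X [^]\<^bsub>G Mod L\<^esub> p = \<one>\<^bsub>G Mod L\<^esub>}"
proof -
  have "inj_on (\<lambda>x. x [^]\<^bsub>G\<^esub> p) (carrier G)"
    using assms by (simp add: inj_on_def vgroup_nat_pow)
  from card_torsion_Mod[OF subgroup_L this generates_mod_pow[OF assms]] show ?thesis
    by (simp only: vgroup_update_carrier one_FactGroup)
qed

lemma order_L_Mod_pos:
  assumes "p > 0"
  shows "order (vgroup L Mod pow_image (vgroup L) p) > 0"
proof -
  interpret L: comm_group "vgroup L" by (rule comm_group_L)
  interpret Q: comm_group "vgroup L Mod pow_image (vgroup L) p"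
    by (rule L.abelian_FactGroup[OF L.subgroup_pow_image])
  show ?thesis using finite_L_Mod[OF assms] by (simp only: Q.order_gt_0_iff_finite)
qed

text \<open>An infinite set has \<open>card\<close> 0, which the positive product in
  \<open>card_torsion\<close> excludes.\<close>

lemma finite_torsion:
  assumes "(p::nat) > 0"
  shows "finite {X \<in> carrier (G Mod L). X [^]\<^bsub>G Mod L\<^esub> p = \<one>\<^bsub>G Mod L\<^esub>}"
  using order_L_Mod_pos[OF assms] unfolding card_torsion[OF assms]
  by (intro card_ge_0_finite) simp

text \<open>The isomorphism carries \<open>L\<close> to a free group of the same rank inside
  rational \<open>'m\<close>-space, whose dimension bounds that rank.\<close>

lemma rank_le:
  fixes H :: "(rat ^ 'm) set"
  assumes H: "group (vgroup H)" and iso: "G \<cong> vgroup H"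
  shows "CARD('n) \<le> CARD('m)"
proof -
  obtain h where h: "h \<in> iso G (vgroup H)" using iso by (auto simp: is_iso_def)
  then interpret h: group_hom G "vgroup H" h
    using H is_group by (simp add: group_hom_def group_hom_axioms_def iso_def)
  have L_sub: "L \<subseteq> dimension_group A" using subgroup.subset[OF subgroup_L] by simp
  have "group (vgroup (h ` L))"
    using group.subgroup_imp_group[OF H h.subgroup_img_is_subgroup[OF subgroup_L]]
    by (simp only: vgroup_update_carrier)
  moreover have "h \<in> iso (vgroup L) (vgroup (h ` L))"
  proof (rule isoI)
    show "h \<in> hom (vgroup L) (vgroup (h ` L))"
      using h.hom_mult L_sub by (intro homI) auto
    show "bij_betw h (carrier (vgroup L)) (carrier (vgroup (h ` L)))"
      using h L_sub by (auto simp: iso_def bij_betw_def intro: inj_on_subset)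
  qed
  then have "vgroup (h ` L) \<cong> vgroup L"
    using group.iso_sym[OF group_L is_isoI] by blast
  then have "vgroup (h ` L) \<cong> free_Abelian_group {..<CARD('n)}"
    using free_L by (rule iso_trans)
  ultimately show ?thesis using free_Abelian_rank_le[of "h ` L" "{..<CARD('n)}"] by simp
qed

end

section \<open>Comparison of the two quotients\<close>

theorem corollary10p3:
  fixes A :: "int ^ 'n ^ 'n" and B :: "int ^ 'm ^ 'm"
    and L :: "(rat ^ 'n) set" and L' :: "(rat ^ 'm) set"
  assumes "det A \<noteq> 0" and "det B \<noteq> 0"
    and "lattice_of_rank CARD('n) (dimension_group A) L"
    and "(*v) (rat_matrix A) ` L \<subseteq> L"
    and "inverse_images A L = dimension_group A"
    and "lattice_of_rank CARD('m) (dimension_group B) L'"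
    and "(*v) (rat_matrix B) ` L' \<subseteq> L'"
    and "inverse_images B L' = dimension_group B"
    and "vgroup (dimension_group A) \<cong> vgroup (dimension_group B)"
  shows "vgroup (dimension_group A) Mod L \<cong> vgroup (dimension_group B) Mod L'"
proof -
  interpret A: invariant_lattice A L using assms by (intro invariant_lattice.intro)
  interpret B: invariant_lattice B L' using assms by (intro invariant_lattice.intro)
  obtain h where h: "h \<in> iso A.G B.G" using assms(9) by (auto simp: is_iso_def)
  have rank: "CARD('n) = CARD('m)"
    using A.rank_le[OF B.is_group assms(9)] B.rank_le[OF A.is_group A.iso_sym[OF assms(9)]]
    by (rule le_antisym)
  \<comment> \<open>Free groups of equal rank are isomorphic. The resulting \<open>k\<close> is
    chosen independently of \<open>h\<close> and serves to equate the orders of \<open>L/pL\<close>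
    and \<open>L'/pL'\<close>.\<close>
  have "vgroup L \<cong> vgroup L'"
    using A.free_L group.iso_sym[OF B.group_L B.free_L] unfolding rank by (rule iso_trans)
  then obtain k where k: "k \<in> iso (vgroup L) (vgroup L')" by (auto simp: is_iso_def)
  have card_eq: "card {X \<in> carrier (A.G Mod L). X [^]\<^bsub>A.G Mod L\<^esub> p = \<one>\<^bsub>A.G Mod L\<^esub>} =
      card {Y \<in> carrier (B.G Mod L'). Y [^]\<^bsub>B.G Mod L'\<^esub> p = \<one>\<^bsub>B.G Mod L'\<^esub>}" if "p > 0" for p :: nat
  proof -
    have "order (vgroup L Mod pow_image (vgroup L) p) = order (vgroup L' Mod pow_image (vgroup L') p)"
      by (rule order_Mod_pow_image_iso[OF A.comm_group_L B.comm_group_L k])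
    moreover have "order (A.G Mod pow_image A.G p) = order (B.G Mod pow_image B.G p)"
      by (rule order_Mod_pow_image_iso[OF A.comm_group_axioms B.comm_group_axioms h])
    \<comment> \<open>Positivity of the order of \<open>L/pL\<close> makes the common order of the
      quotients by \<open>p\<close>-fold multiples nonzero, so it cancels from the two product
      formulas.\<close>
    ultimately show ?thesis
      using A.card_torsion[OF that] B.card_torsion[OF that] A.order_L_Mod_pos[OF that] by simp
  qed
  show ?thesis
  proof (rule divisible_torsion_group_iso)
    show "comm_group (A.G Mod L)" by (rule A.abelian_FactGroup[OF A.subgroup_L])
    show "comm_group (B.G Mod L')" by (rule B.abelian_FactGroup[OF B.subgroup_L])
  qed (use A.torsion_Mod B.torsion_Mod A.divisible_Mod B.divisible_Mod A.finite_torsion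
      B.finite_torsion card_eq prime_gt_0_nat in \<open>simp_all only:\<close>)
qed

end
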